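(* Let $\{X_i,i\geq 1\}$ be a sequence of negatively associated random variables with $\mathbb{E}X_i=0$ for all $i$, let $S_k=\sum_{i=1}^k X_i$, let $n\ge 1$, $0<\alpha<1$ and $p\geq 2$. Assume $$B_n:=\sum_{i=1}^{n}\mathbb{E}[X_i^2]<\infty\quad\text{and}\quad A(p):=\sum_{i=1}^{n}\|X_i\|_{w,p}^p<\infty.$$ Then, for any $x,y>0$, $$\mathbb{P}\Big(\max_{1\leq k\leq n}S_k>x\Big)\leq (1-\alpha)^{-1}H_n\Big(\frac{\alpha x}{y},\frac{\sqrt{B_n}}{y}\Big)+\frac{A(p)}{y^p},$$ where $$H_n(x,v)=\left\{\biggl(\frac{v^2}{x+v^2}\biggr)^{x+v^2}\biggl(\frac{n}{n-x}\biggr)^{n-x}\right\}^{\frac{\alpha n}{n+v^2}}I_{\{x\leq n\}}$$ with the convention that $(+\infty)^0=1$ (which applies when $x=n$).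
   Context: A finite family $\{X_i,1\leq i\leq n\}$ of random variables is negatively associated (NA) if for every pair of disjoint subsets $A_1,A_2$ of $\{1,\dots,n\}$, $\mathrm{Cov}\{f_1(X_i,i\in A_1),f_2(X_j,j\in A_2)\}\leq 0$ whenever $f_1$ and $f_2$ are coordinatewise increasing and the covariance exists. A sequence $\{X_i,i\ge1\}$ is NA if $X_1,\dots,X_n$ is NA for every $n\ge 2$. The weak moment of order $p\ge 1$ of a real-valued random variable $Z$ is $\|Z\|_{w,p}^p=\sup_{x>0}x^p\,\mathbb{P}(|Z|>x)$. $I_A$ denotes the indicator of $A$. Note that $H_n$ depends on $\alpha$. *)

theory Defs
  imports "HOL-Probability.Probability"
begin

definition covariance :: "'a measure \<Rightarrow> ('a \<Rightarrow> real) \<Rightarrow> ('a \<Rightarrow> real) \<Rightarrow> real" where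
  "covariance M U V =
     (\<integral>\<omega>. (U \<omega> - (\<integral>\<omega>'. U \<omega>' \<partial>M)) * (V \<omega> - (\<integral>\<omega>'. V \<omega>' \<partial>M)) \<partial>M)"

definition covariance_exists :: "'a measure \<Rightarrow> ('a \<Rightarrow> real) \<Rightarrow> ('a \<Rightarrow> real) \<Rightarrow> bool" where
  "covariance_exists M U V \<longleftrightarrow>
     integrable M U \<and> integrable M V \<and> integrable M (\<lambda>\<omega>. U \<omega> * V \<omega>)"

text \<open>Real functions on \<open>\<real>\<^sup>A\<close>, with \<open>\<real>\<^sup>A\<close> represented by the extensional functions on \<open>A\<close>.
  The order on functions is pointwise, so \<^const>\<open>mono_on\<close> says that the function is nondecreasing
  in each coordinate. Such a function need not be Borel when \<open>A\<close> has two or more elements, so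
  measurability is required separately.\<close>

definition coordinatewise_increasing :: "nat set \<Rightarrow> ((nat \<Rightarrow> real) \<Rightarrow> real) \<Rightarrow> bool" where
  "coordinatewise_increasing A f \<longleftrightarrow>
     f \<in> borel_measurable (\<Pi>\<^sub>M i\<in>A. borel) \<and> mono_on (A \<rightarrow>\<^sub>E UNIV) f"

definition negatively_associated :: "'a measure \<Rightarrow> nat set \<Rightarrow> (nat \<Rightarrow> 'a \<Rightarrow> real) \<Rightarrow> bool" where
  "negatively_associated M I X \<longleftrightarrow>
     (\<forall>A1 A2 f1 f2. A1 \<subseteq> I \<longrightarrow> A2 \<subseteq> I \<longrightarrow> A1 \<inter> A2 = {} \<longrightarrow>
        coordinatewise_increasing A1 f1 \<longrightarrow> coordinatewise_increasing A2 f2 \<longrightarrow>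
        covariance_exists M (\<lambda>\<omega>. f1 (\<lambda>i\<in>A1. X i \<omega>)) (\<lambda>\<omega>. f2 (\<lambda>j\<in>A2. X j \<omega>)) \<longrightarrow>
        covariance M (\<lambda>\<omega>. f1 (\<lambda>i\<in>A1. X i \<omega>)) (\<lambda>\<omega>. f2 (\<lambda>j\<in>A2. X j \<omega>)) \<le> 0)"

text \<open>Sequences are indexed from \<open>1\<close>; the value \<open>X 0\<close> plays no role.\<close>

definition negatively_associated_seq :: "'a measure \<Rightarrow> (nat \<Rightarrow> 'a \<Rightarrow> real) \<Rightarrow> bool" where
  "negatively_associated_seq M X \<longleftrightarrow> (\<forall>n\<ge>2. negatively_associated M {1..n} X)"

text \<open>This is the \<open>p\<close>-th power \<open>\<parallel>Z\<parallel>\<^bsub>w,p\<^esub>\<^sup>p\<close>, with value \<open>\<infinity>\<close> allowed.\<close>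

definition weak_moment :: "'a measure \<Rightarrow> real \<Rightarrow> ('a \<Rightarrow> real) \<Rightarrow> ennreal" where
  "weak_moment M p Z =
     (SUP x\<in>{0<..}. ennreal (x powr p * measure M {\<omega>\<in>space M. \<bar>Z \<omega>\<bar> > x}))"

definition B_sum :: "'a measure \<Rightarrow> (nat \<Rightarrow> 'a \<Rightarrow> real) \<Rightarrow> nat \<Rightarrow> ennreal" where
  "B_sum M X n = (\<Sum>i=1..n. \<integral>\<^sup>+\<omega>. ennreal ((X i \<omega>)\<^sup>2) \<partial>M)"

definition A_sum :: "'a measure \<Rightarrow> (nat \<Rightarrow> 'a \<Rightarrow> real) \<Rightarrow> nat \<Rightarrow> real \<Rightarrow> ennreal" where
  "A_sum M X n p = (\<Sum>i=1..n. weak_moment M p (X i))"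

text \<open>The case \<open>x = n\<close> is the convention \<open>(+\<infinity>)\<^sup>0 = 1\<close>; without it \<open>n / 0 = 0\<close> and
  \<open>0 powr 0 = 0\<close> would make the factor \<open>0\<close>.\<close>

definition H :: "nat \<Rightarrow> real \<Rightarrow> real \<Rightarrow> real \<Rightarrow> real" where
  "H n \<alpha> x v =
     ((v\<^sup>2 / (x + v\<^sup>2)) powr (x + v\<^sup>2) *
      (if x = real n then 1 else (real n / (real n - x)) powr (real n - x)))
       powr (\<alpha> * real n / (real n + v\<^sup>2))
     * indicator {..real n} x"

end

theory Submission
  imports Defs
begin

text \<open>Off an event of probability at most \<open>A(p) / y\<^sup>p\<close> every \<open>X\<^sub>i\<close> is at most \<open>y\<close>, so one may replace
  \<open>X\<^sub>i\<close> by \<open>U\<^sub>i = min (X\<^sub>i / y) 1\<close>. Bennett's lemma bounds \<open>\<E> exp (t U\<^sub>i)\<close> by the moment generating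
  function \<open>c\<^sub>i \<ge> 1\<close> of a centred two-point law. Write \<open>R\<^sub>k\<close> for the \<open>k\<close>-th partial sum of
  \<open>t U\<^sub>i - ln c\<^sub>i\<close> and \<open>N\<^sub>k\<close> for its running maximum. Doob's inequality for \<open>\<E> exp (\<alpha> N\<^sub>n)\<close> with
  constant \<open>1 / (1 - \<alpha>)\<close> comes from the potential
  \<open>exp (\<alpha> N\<^sub>k) + \<alpha> / (1 - \<alpha>) * exp (R\<^sub>k - (1 - \<alpha>) N\<^sub>k)\<close>. Both \<open>N\<^sub>k\<close> and \<open>R\<^sub>k - N\<^sub>k\<close> are
  increasing in every \<open>X\<^sub>i\<close>, hence so is \<open>R\<^sub>k - (1 - \<alpha>) N\<^sub>k\<close>, and negative association is all that is
  needed to pull the factor \<open>exp (t U\<^sub>k\<^sub>+\<^sub>1)\<close> out of the expectation. Markov's inequality, concavity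
  of the two-point moment generating function in the variance together with AM-GM, and the optimal
  \<open>t\<close> then give \<open>H\<^sub>n\<close>.\<close>

section \<open>Bennett's bound\<close>

text \<open>The ratio \<open>(exp u - 1 - u) / u\<^sup>2\<close> increases in \<open>u\<close>;
  clearing denominators admits \<open>a = 0\<close> as well. For \<open>a \<le> 0 < b\<close> the
  value 1/2 separates the two ratios.\<close>

lemma exp_second_order_bound:
  fixes a b :: real
  assumes "a \<le> b" and "0 < b"
  shows "(exp a - 1 - a) * b\<^sup>2 \<le> a\<^sup>2 * (exp b - 1 - b)"
proof (cases "a \<le> 0")
  case True
  have "(\<lambda>u. exp u - 1 - u - u\<^sup>2 / 2) a \<le> (\<lambda>u. exp u - 1 - u - u\<^sup>2 / 2 :: real) 0"
  proof (rule DERIV_nonneg_imp_nondecreasing[OF True])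
    fix u :: real
    show "\<exists>d. ((\<lambda>u. exp u - 1 - u - u\<^sup>2 / 2) has_real_derivative d) (at u) \<and> 0 \<le> d"
      using exp_ge_add_one_self[of u]
      by (intro exI[of _ "exp u - 1 - u"])
        (auto intro!: derivative_eq_intros simp: le_diff_eq add.commute)
  qed
  then have "(exp a - 1 - a) * b\<^sup>2 \<le> (a\<^sup>2 / 2) * b\<^sup>2"
    by (intro mult_right_mono) auto
  also have "\<dots> = a\<^sup>2 * (b\<^sup>2 / 2)"
    by simp
  also have "\<dots> \<le> a\<^sup>2 * (exp b - 1 - b)"
    using exp_lower_Taylor_quadratic[of b] assms by (intro mult_left_mono) auto
  finally show ?thesis .
next
  case False
  \<comment> \<open>\<open>k u / u ^ 3\<close> is the derivative of
    \<open>(exp u - 1 - u) / u\<^sup>2\<close>, so for \<open>u > 0\<close> only the sign of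
    \<open>k\<close> matters.\<close>
  define k where "k u = (u - 2) * exp u + u + 2" for u :: real
  have k: "0 \<le> k u" if "0 \<le> u" for u
  proof -
    have "k 0 \<le> k u"
    proof (rule DERIV_nonneg_imp_nondecreasing[OF that])
      fix v :: real
      have "(1 - v) * exp v \<le> exp (- v) * exp v"
        using exp_ge_add_one_self[of "- v"] by (intro mult_right_mono) auto
      then have "0 \<le> (v - 1) * exp v + 1"
        by (simp add: exp_minus algebra_simps)
      then show "\<exists>d. (k has_real_derivative d) (at v) \<and> 0 \<le> d"
        unfolding k_def
        by (intro exI[of _ "(v - 1) * exp v + 1"])
          (auto intro!: derivative_eq_intros simp: algebra_simps)
    qed
    then show ?thesis
      by (simp add: k_def)
  qed
  have "(\<lambda>u. (exp u - 1 - u) / u\<^sup>2) a \<le> (\<lambda>u. (exp u - 1 - u) / u\<^sup>2) b"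
  proof (rule DERIV_nonneg_imp_nondecreasing[OF assms(1)])
    fix u assume "a \<le> u"
    then have "0 < u"
      using False by simp
    then show "\<exists>d. ((\<lambda>u. (exp u - 1 - u) / u\<^sup>2) has_real_derivative d) (at u) \<and> 0 \<le> d"
      using k[of u]
      by (intro exI[of _ "k u / u ^ 3"])
        (auto intro!: derivative_eq_intros
          simp: k_def field_simps power2_eq_square power3_eq_cube power4_eq_xxxx)
  qed
  then show ?thesis
    using False assms by (simp add: field_simps)
qed

text \<open>The centred law on \<open>{- s, 1}\<close> has variance \<open>s\<close>.\<close>

definition bennett_mgf :: "real \<Rightarrow> real \<Rightarrow> real" where
  "bennett_mgf t s = (exp (- t * s) + s * exp t) / (1 + s)"

text \<open>The quadratic is tangent to \<open>exp (t u)\<close> at \<open>u = - s\<close> and meets it at \<open>u = 1\<close>, the two atoms of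
  the extremal law.\<close>

lemma exp_le_bennett_quadratic:
  fixes t s u :: real
  assumes "0 \<le> t" "0 \<le> s" "u \<le> 1"
  shows "exp (t * u) \<le> exp (- t * s) *
    (1 + t * (u + s) + (exp (t * (1 + s)) - 1 - t * (1 + s)) / (1 + s)\<^sup>2 * (u + s)\<^sup>2)"
proof (cases "t = 0")
  case False
  let ?z = "1 + s"
  let ?h = "exp (t * ?z) - 1 - t * ?z"
  \<comment> \<open>The bound is applied with \<open>a = t * (u + s)\<close> and
    \<open>b = t * (1 + s)\<close>, ordered because \<open>u \<le> 1\<close>. The common factor
    \<open>t\<^sup>2\<close> is then cancelled, which is why \<open>t = 0\<close> is split
    off.\<close>
  have "(exp (t * (u + s)) - 1 - t * (u + s)) * (t * ?z)\<^sup>2 \<le> (t * (u + s))\<^sup>2 * ?h"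
    using assms False by (intro exp_second_order_bound) (auto intro: mult_left_mono)
  then have "t\<^sup>2 * ((exp (t * (u + s)) - 1 - t * (u + s)) * ?z\<^sup>2) \<le> t\<^sup>2 * ((u + s)\<^sup>2 * ?h)"
    by (simp only: power_mult_distrib mult.assoc mult.left_commute[of _ "t\<^sup>2"])
  then have "(exp (t * (u + s)) - 1 - t * (u + s)) * ?z\<^sup>2 \<le> (u + s)\<^sup>2 * ?h"
    using False by simp
  moreover have "0 < ?z\<^sup>2"
    using assms by simp
  ultimately have "exp (t * (u + s)) - 1 - t * (u + s) \<le> (u + s)\<^sup>2 * ?h / ?z\<^sup>2"
    by (simp add: pos_le_divide_eq)
  then have "exp (t * (u + s)) \<le> 1 + t * (u + s) + ?h / ?z\<^sup>2 * (u + s)\<^sup>2"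
    by (simp add: mult.commute)
  then have "exp (- t * s) * exp (t * (u + s)) \<le>
      exp (- t * s) * (1 + t * (u + s) + ?h / ?z\<^sup>2 * (u + s)\<^sup>2)"
    by (intro mult_left_mono) auto
  moreover have "exp (- t * s) * exp (t * (u + s)) = exp (t * u)"
    by (simp add: exp_add[symmetric] algebra_simps)
  ultimately show ?thesis
    by metis
qed simp

text \<open>This is Jensen's inequality for a centred law, obtained from the tangent bound on both
  exponentials. It makes the logarithms subtracted in the truncation argument nonnegative.\<close>

lemma one_le_bennett_mgf:
  assumes "0 \<le> s"
  shows "1 \<le> bennett_mgf t s"
proof -
  have "s * (1 + t) \<le> s * exp t"
    using assms exp_ge_add_one_self[of t] by (intro mult_left_mono) auto
  then have "1 + s \<le> exp (- t * s) + s * exp t"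
    using exp_ge_add_one_self[of "- t * s"] by (simp add: algebra_simps)
  then show ?thesis
    using assms by (simp add: bennett_mgf_def)
qed

text \<open>Integrating the quadratic majorant leaves only the first two moments, with nonnegative
  coefficients. Upper bounds on these moments therefore suffice, which suits truncated variables:
  truncation may lower both.\<close>

lemma (in prob_space) expectation_exp_le_bennett_mgf:
  fixes U :: "'a \<Rightarrow> real"
  assumes U: "integrable M U" "integrable M (\<lambda>\<omega>. (U \<omega>)\<^sup>2)"
    and le1: "\<And>\<omega>. \<omega> \<in> space M \<Longrightarrow> U \<omega> \<le> 1"
    and mean: "expectation U \<le> 0" and second: "expectation (\<lambda>\<omega>. (U \<omega>)\<^sup>2) \<le> s"
    and t: "0 \<le> t"
  shows "expectation (\<lambda>\<omega>. exp (t * U \<omega>)) \<le> bennett_mgf t s"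
proof -
  have "0 \<le> expectation (\<lambda>\<omega>. (U \<omega>)\<^sup>2)"
    by simp
  then have s: "0 \<le> s"
    using second by linarith
  define z where "z = 1 + s"
  have z: "1 \<le> z"
    using s by (simp add: z_def)
  define c where "c = (exp (t * z) - 1 - t * z) / z\<^sup>2"
  have c: "0 \<le> c"
    using exp_ge_add_one_self[of "t * z"] unfolding c_def
    by (intro divide_nonneg_nonneg) (simp_all add: le_diff_eq add.commute)
  have exp_int: "integrable M (\<lambda>\<omega>. exp (t * U \<omega>))"
  proof (rule integrable_const_bound[where B = "exp t"])
    show "AE \<omega> in M. norm (exp (t * U \<omega>)) \<le> exp t"
      using le1 t mult_left_mono[of _ 1 t] by (auto intro!: AE_I2)
  qed (use U in measurable)
  have sq: "(U \<omega> + s)\<^sup>2 = (U \<omega>)\<^sup>2 + 2 * s * U \<omega> + s\<^sup>2" for \<omega>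
    by (simp add: power2_eq_square algebra_simps)
  have "expectation (\<lambda>\<omega>. exp (t * U \<omega>)) \<le>
      expectation (\<lambda>\<omega>. exp (- t * s) * (1 + t * (U \<omega> + s) + c * (U \<omega> + s)\<^sup>2))"
  proof (rule integral_mono[OF exp_int])
    show "integrable M (\<lambda>\<omega>. exp (- t * s) * (1 + t * (U \<omega> + s) + c * (U \<omega> + s)\<^sup>2))"
      using U by (simp add: sq)
    show "exp (t * U \<omega>) \<le> exp (- t * s) * (1 + t * (U \<omega> + s) + c * (U \<omega> + s)\<^sup>2)"
      if "\<omega> \<in> space M" for \<omega>
      unfolding c_def z_def using t s le1[OF that] by (rule exp_le_bennett_quadratic)
  qed
  also have "\<dots> = exp (- t * s) * (1 + t * (expectation U + s) +
      c * (expectation (\<lambda>\<omega>. (U \<omega>)\<^sup>2) + 2 * s * expectation U + s\<^sup>2))"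
    using U by (simp add: sq prob_space)
  also have "\<dots> \<le> exp (- t * s) * (1 + t * (0 + s) + c * (s + 2 * s * 0 + s\<^sup>2))"
    using mean second s t c
    by (intro mult_left_mono add_mono order_refl) (auto intro: mult_nonneg_nonpos)
  \<comment> \<open>The left side is the integral of the quadratic under the two-point law, on whose
    atoms it agrees with the exponential.\<close>
  also have "\<dots> = bennett_mgf t s"
  proof -
    have "s + s\<^sup>2 = s * z"
      by (simp add: z_def power2_eq_square algebra_simps)
    then have "c * (s + s\<^sup>2) = s / z * (exp (t * z) - 1 - t * z)"
      using z by (simp add: c_def power2_eq_square)
    then have "1 + t * s + c * (s + s\<^sup>2) = (1 + s * exp (t * z)) / z"
      using z by (simp add: z_def field_simps)
    then have "exp (- t * s) * (1 + t * (0 + s) + c * (s + 2 * s * 0 + s\<^sup>2)) =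
        (exp (- t * s) + s * (exp (- t * s) * exp (t * z))) / z"
      by (simp add: distrib_left mult.left_commute)
    also have "exp (- t * s) * exp (t * z) = exp t"
      by (simp add: exp_add[symmetric] z_def algebra_simps)
    finally show ?thesis
      by (simp add: bennett_mgf_def z_def)
  qed
  finally show ?thesis .
qed

section \<open>Concavity in the variance and the optimal exponential parameter\<close>

lemma convex_on_one_minus_exp_div:
  fixes t :: real
  assumes "0 \<le> t"
  shows "convex_on {0<..} (\<lambda>z. (1 - exp (- t * z)) / z)"
proof (rule f''_ge0_imp_convex)
  fix z :: real assume "z \<in> {0<..}"
  then have z: "0 < z" by simp
  show "((\<lambda>z. (1 - exp (- t * z)) / z) has_real_derivative
      (exp (- t * z) * (1 + t * z) - 1) / z\<^sup>2) (at z)"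
    using z by (auto intro!: derivative_eq_intros simp: field_simps power2_eq_square)
  show "((\<lambda>z. (exp (- t * z) * (1 + t * z) - 1) / z\<^sup>2) has_real_derivative
      (2 - exp (- t * z) * (2 + 2 * (t * z) + (t * z)\<^sup>2)) / z ^ 3) (at z)"
    using z by (auto intro!: derivative_eq_intros simp: field_simps power2_eq_square power3_eq_cube power4_eq_xxxx)
  \<comment> \<open>The sign of the second derivative reduces to the Taylor bound
    \<open>1 + t * z + (t * z)\<^sup>2 / 2 \<le> exp (t * z)\<close>.\<close>
  have "exp (- t * z) * (2 + 2 * (t * z) + (t * z)\<^sup>2) \<le> exp (- t * z) * (2 * exp (t * z))"
    using exp_lower_Taylor_quadratic[of "t * z"] assms z by (intro mult_left_mono) auto
  also have "\<dots> = 2"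
    by (simp add: exp_minus)
  finally show "0 \<le> (2 - exp (- t * z) * (2 + 2 * (t * z) + (t * z)\<^sup>2)) / z ^ 3"
    using z by (intro divide_nonneg_nonneg) auto
qed simp

text \<open>With \<open>\<phi> z = (1 - exp (- t z)) / z\<close> convex, \<open>bennett_mgf t s = exp t * (1 - \<phi> (1 + s))\<close> is concave
  in \<open>s\<close>, and AM-GM reduces the claim to Jensen's inequality.\<close>

lemma prod_bennett_mgf_le:
  fixes s :: "'i \<Rightarrow> real"
  assumes I: "finite I" "I \<noteq> {}" and s: "\<And>i. i \<in> I \<Longrightarrow> 0 \<le> s i" and t: "0 \<le> t"
  shows "(\<Prod>i\<in>I. bennett_mgf t (s i)) \<le> bennett_mgf t ((\<Sum>i\<in>I. s i) / card I) ^ card I"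
proof -
  define \<phi> where "\<phi> z = (1 - exp (- t * z)) / z" for z :: real
  have bennett: "bennett_mgf t r = exp t * (1 - \<phi> (1 + r))" if "0 \<le> r" for r
    using that unfolding bennett_mgf_def \<phi>_def by (simp add: field_simps exp_add[symmetric])
  let ?n = "real (card I)"
  have n: "0 < ?n"
    using I by (simp add: card_gt_0_iff)
  define m where "m = (\<Sum>i\<in>I. s i) / ?n"
  have m: "0 \<le> m"
    using s by (auto simp: m_def sum_nonneg)
  have mean: "(\<Sum>i\<in>I. (1 / ?n) *\<^sub>R (1 + s i)) = 1 + m"
    using n by (simp add: m_def sum_divide_distrib[symmetric] sum.distrib field_simps)
  have "\<phi> (\<Sum>i\<in>I. (1 / ?n) *\<^sub>R (1 + s i)) \<le> (\<Sum>i\<in>I. (1 / ?n) * \<phi> (1 + s i))"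
    unfolding \<phi>_def
    using I n s by (intro convex_on_sum[OF _ _ convex_on_one_minus_exp_div[OF t]])
      (auto intro: add_pos_nonneg)
  then have "?n * \<phi> (1 + m) \<le> (\<Sum>i\<in>I. \<phi> (1 + s i))"
    unfolding mean sum_distrib_left[symmetric] using n by (simp add: field_simps)
  then have "exp t * (?n - (\<Sum>i\<in>I. \<phi> (1 + s i))) \<le> exp t * (?n - ?n * \<phi> (1 + m))"
    by (intro mult_left_mono) auto
  then have "(\<Sum>i\<in>I. bennett_mgf t (s i)) \<le> ?n * bennett_mgf t m"
    using m s by (simp add: bennett sum_distrib_left[symmetric] sum_subtractf algebra_simps)
  then have avg: "(\<Sum>i\<in>I. bennett_mgf t (s i)) / ?n \<le> bennett_mgf t m"
    using n by (simp add: pos_divide_le_eq mult.commute)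
  have "(\<Prod>i\<in>I. bennett_mgf t (s i)) \<le> ((\<Sum>i\<in>I. bennett_mgf t (s i)) / ?n) ^ card I"
  proof -
    let ?P = "\<Prod>i\<in>I. bennett_mgf t (s i)"
    have "0 < ?P"
      using s one_le_bennett_mgf[of "s _" t] by (intro prod_pos) (auto intro: less_le_trans[OF zero_less_one])
    then have "?P = (?P powr (1 / ?n)) ^ card I"
      using n by (simp add: powr_power)
    also have "\<dots> \<le> (\<Sum>i\<in>I. bennett_mgf t (s i) / ?n) ^ card I"
      using I s one_le_bennett_mgf[of "s _" t]
      by (intro power_mono arith_geom_mean) (auto intro: order_trans[OF zero_le_one])
    finally show ?thesis
      by (simp add: sum_divide_distrib)
  qed
  also have "\<dots> \<le> bennett_mgf t m ^ card I"
    using avg s by (intro power_mono divide_nonneg_nonneg sum_nonneg) (auto simp: bennett_mgf_def)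
  finally show ?thesis
    unfolding m_def .
qed

text \<open>With the mean variance \<open>w = V / n\<close>, setting the derivative of
  \<open>- t * x + n * ln (bennett_mgf t w)\<close> to zero gives
  \<open>w * exp (t * (1 + w)) = (x + V) / (n - x)\<close>. The strict inequalities keep the
  logarithm of the solution meaningful.\<close>

lemma exists_optimal_bennett_parameter:
  fixes s :: "nat \<Rightarrow> real" and V x :: real
  assumes s: "\<And>i. i \<in> {1..n} \<Longrightarrow> 0 \<le> s i" and V: "(\<Sum>i=1..n. s i) = V" "0 < V"
    and x: "0 < x" "x < real n"
  obtains t where "0 < t"
    "exp (- t * x) * (\<Prod>i=1..n. bennett_mgf t (s i)) \<le>
      ((V / (x + V)) powr (x + V) * (n / (n - x)) powr (n - x)) powr (n / (n + V))"
proof -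
  define w where "w = V / n"
  \<comment> \<open>\<open>exp (- a)\<close> and \<open>exp b\<close> are the two bases of the final
    bound, and \<open>t\<close> solves the stationarity equation
    \<open>t * (1 + w) = a + b\<close>.\<close>
  define a where "a = ln ((x + V) / V)"
  define b where "b = ln (n / (n - x))"
  define t where "t = (a + b) / (1 + w)"
  have n: "0 < real n" "n \<noteq> 0"
    using x by auto
  have w: "0 < w" "V = w * n"
    using V n by (simp_all add: w_def)
  have pos: "0 < a" "0 < b"
    using V x by (simp_all add: a_def b_def)
  then have t: "0 < t"
    using w by (simp add: t_def)
  have exps: "exp a = (x + V) / V" "exp b = n / (n - x)"
    using V x by (simp_all add: a_def b_def)
  have "exp t = exp (- t * w) * exp (t * (1 + w))"
    by (simp add: exp_add[symmetric] algebra_simps)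
  then have "bennett_mgf t w = exp (- t * w) * ((1 + w * exp (t * (1 + w))) / (1 + w))"
    by (simp add: bennett_mgf_def algebra_simps)
  also have "exp (t * (1 + w)) = exp a * exp b"
    using w by (simp add: t_def exp_add)
  \<comment> \<open>At the stationary point this factor collapses to one of the two bases.\<close>
  also have "(1 + w * (exp a * exp b)) / (1 + w) = exp b"
  proof -
    have "w * (exp a * exp b) = (x + V) / (n - x)"
      using w n by (simp add: exps)
    then show ?thesis
      using w x n by (simp add: exps divide_simps) (simp add: algebra_simps)
  qed
  finally have opt: "bennett_mgf t w = exp (- t * w) * exp b" .
  have "exp (- t * x) * (\<Prod>i=1..n. bennett_mgf t (s i)) \<le> exp (- t * x) * bennett_mgf t w ^ n"
    using prod_bennett_mgf_le[of "{1..n}" s t] s t n V(1)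
    by (intro mult_left_mono) (simp_all add: w_def)
  also have "\<dots> = exp (- t * x + n * (- t * w + b))"
    by (simp add: opt exp_add[symmetric] exp_of_nat_mult[symmetric])
  \<comment> \<open>Here \<open>1 / (1 + w) = n / (n + V)\<close> produces the outer
    exponent.\<close>
  also have "- t * x + n * (- t * w + b) = n / (n + V) * ((x + V) * - a + (n - x) * b)"
  proof -
    have "n + V = n * (1 + w)"
      using w by (simp add: algebra_simps)
    then have "n / (n + V) = 1 / (1 + w)"
      using n by simp
    moreover have "- t * x + n * (- t * w + b) = n * b - (a + b) * (x + V) / (1 + w)"
      by (simp add: w t_def algebra_simps add_divide_distrib)
    moreover have "n * b = (n + V) * b / (1 + w)"
      using w by (simp add: field_simps)
    moreover have "(n + V) * b - (a + b) * (x + V) = (x + V) * - a + (n - x) * b"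
      by (simp add: algebra_simps)
    ultimately show ?thesis
      by (metis diff_divide_distrib mult_1 times_divide_eq_left)
  qed
  also have "exp \<dots> = ((V / (x + V)) powr (x + V) * (n / (n - x)) powr (n - x)) powr (n / (n + V))"
  proof -
    have "(V / (x + V)) = exp (- a)"
      using V x by (simp add: exps exp_minus)
    then show ?thesis
      by (simp add: exps(2)[symmetric] powr_def exp_add[symmetric])
  qed
  finally show thesis
    using that[OF t] by blast
qed

section \<open>A maximal inequality under negative association\<close>

text \<open>Including the empty sum keeps the maximum nonnegative and starts the Doob potential at
  \<open>1 / (1 - \<alpha>)\<close>.\<close>

primrec running_max :: "(nat \<Rightarrow> real) \<Rightarrow> nat \<Rightarrow> real" where
  "running_max z 0 = 0"
| "running_max z (Suc k) = max (running_max z k) (\<Sum>i=1..Suc k. z i)"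

lemma sum_le_running_max: "k \<le> n \<Longrightarrow> (\<Sum>i=1..k. z i) \<le> running_max z n"
  by (induction n) (auto simp: le_Suc_eq)

lemma running_max_nonneg: "0 \<le> running_max z n"
  using sum_le_running_max[of 0 n z] by simp

lemma running_max_mono:
  assumes "\<And>i. i \<in> {1..n} \<Longrightarrow> z i \<le> z' i"
  shows "running_max z n \<le> running_max z' n"
  using assms
proof (induction n)
  case (Suc n)
  have "(\<Sum>i=1..Suc n. z i) \<le> (\<Sum>i=1..Suc n. z' i)"
    using Suc.prems by (intro sum_mono) auto
  then show ?case
    using Suc by (auto intro: max.mono)
qed simp

lemma running_max_le:
  assumes "\<And>i. i \<in> {1..n} \<Longrightarrow> z i \<le> c" "0 \<le> c"
  shows "running_max z n \<le> n * c"
  using assms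
proof (induction n)
  case (Suc n)
  have "(\<Sum>i=1..Suc n. z i) \<le> of_nat (card {1..Suc n}) * c"
    using Suc.prems by (intro sum_bounded_above) auto
  moreover have "running_max z n \<le> n * c"
    using Suc by auto
  ultimately show ?case
    using Suc.prems(2) by (auto simp: algebra_simps)
qed simp

text \<open>The drawdown obeys the Lindley recursion, so it decreases with every increment.\<close>

lemma sum_minus_running_max_mono:
  assumes "\<And>i. i \<in> {1..n} \<Longrightarrow> z i \<le> z' i"
  shows "(\<Sum>i=1..n. z i) - running_max z n \<le> (\<Sum>i=1..n. z' i) - running_max z' n"
  using assms
proof (induction n)
  case (Suc n)
  have step: "(\<Sum>i=1..Suc n. u i) - running_max u (Suc n) =
      min ((\<Sum>i=1..n. u i) - running_max u n + u (Suc n)) 0" for u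
    by (auto simp: max_def min_def)
  have "(\<Sum>i=1..n. z i) - running_max z n \<le> (\<Sum>i=1..n. z' i) - running_max z' n"
    using Suc by auto
  moreover have "z (Suc n) \<le> z' (Suc n)"
    using Suc.prems by auto
  ultimately show ?case
    unfolding step by (intro min.mono add_mono) auto
qed simp

lemma borel_measurable_running_max[measurable (raw)]:
  fixes z :: "nat \<Rightarrow> 'a \<Rightarrow> real"
  assumes "\<And>i. i \<in> {1..n} \<Longrightarrow> z i \<in> borel_measurable N"
  shows "(\<lambda>\<omega>. running_max (\<lambda>i. z i \<omega>) n) \<in> borel_measurable N"
  using assms by (induction n) (auto intro!: borel_measurable_max borel_measurable_sum)

lemma running_max_cong:
  "(\<And>i. i \<in> {1..n} \<Longrightarrow> z i = z' i) \<Longrightarrow> running_max z n = running_max z' n"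
  by (intro antisym running_max_mono) auto

section \<open>A Doob-type moment bound from covariance inequalities\<close>

lemma (in prob_space) covariance_eq:
  assumes "covariance_exists M U V"
  shows "covariance M U V = expectation (\<lambda>\<omega>. U \<omega> * V \<omega>) - expectation U * expectation V"
proof -
  have [simp]: "integrable M U" "integrable M V" "integrable M (\<lambda>\<omega>. U \<omega> * V \<omega>)"
    using assms by (auto simp: covariance_exists_def)
  have "covariance M U V = expectation (\<lambda>\<omega>. U \<omega> * V \<omega> - U \<omega> * expectation V
      - expectation U * V \<omega> + expectation U * expectation V)"
    unfolding covariance_def by (intro Bochner_Integration.integral_cong) (auto simp: algebra_simps)
  also have "\<dots> = expectation (\<lambda>\<omega>. U \<omega> * V \<omega>) - expectation U * expectation V"
    by (simp add: prob_space)
  finally show ?thesis .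
qed

text \<open>For a nonnegative supermartingale with running maximum \<open>exp m\<close> and current value \<open>exp r\<close>, the weak
  type bound \<open>exp r / \<lambda>\<close> for exceeding \<open>\<lambda>\<close> integrates to this bound for the \<open>\<alpha>\<close>-th moment of the
  final maximum.\<close>

definition doob_potential :: "real \<Rightarrow> real \<Rightarrow> real \<Rightarrow> real" where
  "doob_potential \<alpha> m r = exp (\<alpha> * m) + \<alpha> / (1 - \<alpha>) * exp (r - (1 - \<alpha>) * m)"

text \<open>At a new record the claim rescales to
  \<open>exp (\<alpha> * d) \<le> 1 - \<alpha> + \<alpha> * exp d\<close> with
  \<open>d = r - m\<close>, which is convexity of \<open>exp\<close>. Hence the old maximum may be
  kept while the next increment is averaged out.\<close>

lemma doob_potential_max_le:
  assumes "0 < \<alpha>" "\<alpha> < 1"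
  shows "doob_potential \<alpha> (max m r) r \<le> doob_potential \<alpha> m r"
proof (cases "r \<le> m")
  case False
  have "exp ((1 - \<alpha>) *\<^sub>R 0 + \<alpha> *\<^sub>R (r - m)) \<le> (1 - \<alpha>) * exp 0 + \<alpha> * exp (r - m)"
    using assms by (intro convex_onD[OF exp_convex, of \<alpha> 0 "r - m"]) auto
  then have "exp (\<alpha> * (r - m)) / (1 - \<alpha>) \<le> 1 + \<alpha> / (1 - \<alpha>) * exp (r - m)"
    using assms divide_right_mono[of _ _ "1 - \<alpha>"] by (fastforce simp: add_divide_distrib)
  then have "exp (\<alpha> * m) * (exp (\<alpha> * (r - m)) / (1 - \<alpha>)) \<le>
      exp (\<alpha> * m) * (1 + \<alpha> / (1 - \<alpha>) * exp (r - m))"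
    by (intro mult_left_mono) auto
  moreover have "doob_potential \<alpha> (max m r) r = exp (\<alpha> * r) / (1 - \<alpha>)"
    using False assms by (simp add: doob_potential_def max_def algebra_simps divide_simps)
  moreover have "\<alpha> * m + \<alpha> * (r - m) = \<alpha> * r" "\<alpha> * m + (r - m) = r - (1 - \<alpha>) * m"
    by (simp_all add: algebra_simps)
  ultimately show ?thesis
    by (simp add: doob_potential_def exp_add[symmetric] distrib_left mult.left_commute[of "exp _"])
qed (simp add: max_def)

text \<open>Exponential moments at most 1, combined with negative association, stand in for the
  supermartingale property. The upper bound \<open>c\<close> makes all exponentials involved
  bounded, hence integrable.\<close>

lemma (in prob_space) expectation_exp_running_max_le:
  fixes X :: "nat \<Rightarrow> 'a \<Rightarrow> real" and h :: "nat \<Rightarrow> real \<Rightarrow> real"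
  assumes NA: "negatively_associated M {1..n} X"
    and X: "\<And>i. i \<in> {1..n} \<Longrightarrow> X i \<in> borel_measurable M"
    and h: "\<And>i. i \<in> {1..n} \<Longrightarrow> mono (h i)"
    and bound: "\<And>i u. i \<in> {1..n} \<Longrightarrow> h i u \<le> c"
    and mgf: "\<And>i. i \<in> {1..n} \<Longrightarrow> expectation (\<lambda>\<omega>. exp (h i (X i \<omega>))) \<le> 1"
    and \<alpha>: "0 < \<alpha>" "\<alpha> < 1"
  shows "expectation (\<lambda>\<omega>. exp (\<alpha> * running_max (\<lambda>i. h i (X i \<omega>)) n)) \<le> 1 / (1 - \<alpha>)"
proof -
  define R where "R k \<omega> = (\<Sum>i=1..k. h i (X i \<omega>))" for k \<omega>
  define N where "N k \<omega> = running_max (\<lambda>i. h i (X i \<omega>)) k" for k \<omega>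
  define W where "W k \<omega> = exp (R k \<omega> - (1 - \<alpha>) * N k \<omega>)" for k \<omega>
  \<comment> \<open>A nonnegative constant is required for \<open>k * C \<le> n * C\<close>.\<close>
  define C where "C = max c 0"
  have C: "0 \<le> C" "\<And>i u. i \<in> {1..n} \<Longrightarrow> h i u \<le> C"
    using bound by (auto simp: C_def le_max_iff_disj)
  have h_meas[measurable]: "h i \<in> borel_measurable borel" if "i \<in> {1..n}" for i
    using h[OF that] by (rule borel_measurable_mono)
  have hX[measurable]: "(\<lambda>\<omega>. h i (X i \<omega>)) \<in> borel_measurable M" if "i \<in> {1..n}" for i
    using measurable_compose[OF X[OF that] h_meas[OF that]] .
  have N_meas: "N k \<in> borel_measurable M" if "k \<le> n" for k
    using that hX unfolding N_def by (intro borel_measurable_running_max) auto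
  have R_meas: "R k \<in> borel_measurable M" if "k \<le> n" for k
    using that hX unfolding R_def by (intro borel_measurable_sum) auto
  have N_nonneg: "0 \<le> N k \<omega>" for k \<omega>
    by (simp add: N_def running_max_nonneg)
  have N_le: "N k \<omega> \<le> n * C" if "k \<le> n" for k \<omega>
  proof -
    have "N k \<omega> \<le> k * C"
      unfolding N_def using C that by (intro running_max_le) auto
    also have "\<dots> \<le> n * C"
      using that C by (intro mult_right_mono) auto
    finally show ?thesis .
  qed
  have R_le_N: "R k \<omega> \<le> N k \<omega>" for k \<omega>
    unfolding R_def N_def by (rule sum_le_running_max) simp
  have expN_int: "integrable M (\<lambda>\<omega>. exp (\<alpha> * N k \<omega>))" if "k \<le> n" for k
    using that N_meas[OF that] N_le[OF that] \<alpha>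
    by (intro integrable_const_bound[where B = "exp (\<alpha> * (n * C))"]) (auto intro!: AE_I2)
  have W_le: "W k \<omega> \<le> exp (\<alpha> * (n * C))" if "k \<le> n" for k \<omega>
  proof -
    have "R k \<omega> - (1 - \<alpha>) * N k \<omega> \<le> \<alpha> * N k \<omega>"
      using R_le_N[of k \<omega>] by (simp add: algebra_simps)
    also have "\<dots> \<le> \<alpha> * (n * C)"
      using N_le[OF that] \<alpha> by simp
    finally show ?thesis
      by (simp add: W_def)
  qed
  have W_meas: "W k \<in> borel_measurable M" if "k \<le> n" for k
    unfolding W_def using N_meas[OF that] R_meas[OF that] by measurable
  have W_int: "integrable M (W k)" if "k \<le> n" for k
    using W_meas[OF that] W_le[OF that]
    by (intro integrable_const_bound[where B = "exp (\<alpha> * (n * C))"])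
      (auto intro!: AE_I2 simp: W_def)
  have V_le: "exp (h i (X i \<omega>)) \<le> exp C" if "i \<in> {1..n}" for i \<omega>
    using C that by auto
  have V_int: "integrable M (\<lambda>\<omega>. exp (h i (X i \<omega>)))" if "i \<in> {1..n}" for i
    using hX[OF that] V_le[OF that]
    by (intro integrable_const_bound[where B = "exp C"]) (auto intro!: AE_I2)
  have WV_int: "integrable M (\<lambda>\<omega>. W k \<omega> * exp (h (Suc k) (X (Suc k) \<omega>)))" if "Suc k \<le> n" for k
  proof (rule integrable_const_bound[where B = "exp (\<alpha> * (n * C)) * exp C"])
    show "AE \<omega> in M. norm (W k \<omega> * exp (h (Suc k) (X (Suc k) \<omega>))) \<le> exp (\<alpha> * (n * C)) * exp C"
      using that W_le[of k] V_le[of "Suc k"]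
      by (intro AE_I2) (auto simp: abs_mult W_def intro!: mult_mono)
    show "(\<lambda>\<omega>. W k \<omega> * exp (h (Suc k) (X (Suc k) \<omega>))) \<in> borel_measurable M"
      using that W_meas[of k] hX[of "Suc k"] by simp
  qed
  have na_step: "expectation (\<lambda>\<omega>. W k \<omega> * exp (h (Suc k) (X (Suc k) \<omega>))) \<le> expectation (W k)"
    if k: "Suc k \<le> n" for k
  proof -
    \<comment> \<open>\<open>f1\<close> is \<open>W k\<close> as a function of the first
      \<open>k\<close> coordinates, while \<open>f2\<close> reads only coordinate
      \<open>Suc k\<close>, so the index sets are disjoint.\<close>
    define f1 where "f1 g = exp ((\<Sum>i=1..k. h i (g i)) - (1 - \<alpha>) * running_max (\<lambda>i. h i (g i)) k)"
      for g :: "nat \<Rightarrow> real"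
    define f2 where "f2 g = exp (h (Suc k) (g (Suc k)))" for g :: "nat \<Rightarrow> real"
    have h_comp: "(\<lambda>g. h i (g i)) \<in> borel_measurable (\<Pi>\<^sub>M i\<in>A. borel)" if "i \<in> {1..n}" "i \<in> A" for i A
      using h_meas[OF that(1)] that(2) by measurable
    have "coordinatewise_increasing {1..k} f1"
      unfolding coordinatewise_increasing_def
    proof
      have [measurable]: "(\<lambda>g. \<Sum>i=1..k. h i (g i)) \<in> borel_measurable (\<Pi>\<^sub>M i\<in>{1..k}. borel)"
        using k by (intro borel_measurable_sum h_comp) auto
      have [measurable]: "(\<lambda>g. running_max (\<lambda>i. h i (g i)) k) \<in> borel_measurable (\<Pi>\<^sub>M i\<in>{1..k}. borel)"
        using k by (intro borel_measurable_running_max h_comp) auto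
      show "f1 \<in> borel_measurable (\<Pi>\<^sub>M i\<in>{1..k}. borel)"
        unfolding f1_def by measurable
      show "mono_on ({1..k} \<rightarrow>\<^sub>E UNIV) f1"
      proof (rule mono_onI)
        fix g g' :: "nat \<Rightarrow> real" assume "g \<le> g'"
        then have le: "h i (g i) \<le> h i (g' i)" if "i \<in> {1..k}" for i
          using h[of i] k that by (auto simp: le_fun_def mono_def)
        have split: "s - (1 - \<alpha>) * m = s - m + \<alpha> * m" for s m
          by (simp add: algebra_simps)
        show "f1 g \<le> f1 g'"
          using sum_minus_running_max_mono[OF le] running_max_mono[OF le] \<alpha>
          by (auto simp: f1_def split intro!: add_mono)
      qed
    qed
    moreover have "coordinatewise_increasing {Suc k} f2"
      unfolding coordinatewise_increasing_def
    proof
      show "f2 \<in> borel_measurable (\<Pi>\<^sub>M i\<in>{Suc k}. borel)"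
        unfolding f2_def using k by (intro borel_measurable_exp[THEN measurable_compose[rotated]] h_comp) auto
      show "mono_on ({Suc k} \<rightarrow>\<^sub>E UNIV) f2"
        using h[of "Suc k"] k by (auto simp: mono_on_def mono_def le_fun_def f2_def)
    qed
    moreover have f1: "(\<lambda>\<omega>. f1 (\<lambda>i\<in>{1..k}. X i \<omega>)) = W k"
      by (auto simp: f1_def W_def R_def N_def intro!: ext arg_cong2[of _ _ _ _ "(-)"] running_max_cong)
    moreover have f2: "(\<lambda>\<omega>. f2 (\<lambda>i\<in>{Suc k}. X i \<omega>)) = (\<lambda>\<omega>. exp (h (Suc k) (X (Suc k) \<omega>)))"
      by (simp add: f2_def)
    moreover have ex: "covariance_exists M (W k) (\<lambda>\<omega>. exp (h (Suc k) (X (Suc k) \<omega>)))"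
      using k W_int[of k] V_int[of "Suc k"] WV_int[of k] by (simp add: covariance_exists_def)
    moreover have "{1..k} \<subseteq> {1..n}" "{Suc k} \<subseteq> {1..n}" "{1..k} \<inter> {Suc k} = {}"
      using k by auto
    ultimately have "covariance M (W k) (\<lambda>\<omega>. exp (h (Suc k) (X (Suc k) \<omega>))) \<le> 0"
      using NA[unfolded negatively_associated_def, rule_format, of "{1..k}" "{Suc k}" f1 f2]
      by simp
    then have "expectation (\<lambda>\<omega>. W k \<omega> * exp (h (Suc k) (X (Suc k) \<omega>))) \<le>
        expectation (W k) * expectation (\<lambda>\<omega>. exp (h (Suc k) (X (Suc k) \<omega>)))"
      by (simp add: covariance_eq[OF ex])
    also have "\<dots> \<le> expectation (W k) * 1"
      using mgf[of "Suc k"] k by (intro mult_left_mono) (auto simp: W_def)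
    finally show ?thesis
      by simp
  qed
  have potential: "(\<lambda>\<omega>. doob_potential \<alpha> (N k \<omega>) (R k \<omega>)) =
      (\<lambda>\<omega>. exp (\<alpha> * N k \<omega>) + \<alpha> / (1 - \<alpha>) * W k \<omega>)" for k
    by (simp add: doob_potential_def W_def)
  have pot_int: "integrable M (\<lambda>\<omega>. doob_potential \<alpha> (N k \<omega>) (R k \<omega>))" if "k \<le> n" for k
    unfolding potential using that expN_int W_int by auto
  have main: "expectation (\<lambda>\<omega>. doob_potential \<alpha> (N k \<omega>) (R k \<omega>)) \<le> 1 / (1 - \<alpha>)" if "k \<le> n" for k
    using that
  proof (induction k)
    case 0
    show ?case
      using \<alpha> by (simp add: R_def N_def doob_potential_def prob_space divide_simps)
  next
    case (Suc k)
    \<comment> \<open>With the old maximum \<open>N k\<close> retained, the next increment enters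
      only as a factor on \<open>W k\<close>.\<close>
    have step: "doob_potential \<alpha> (N k \<omega>) (R (Suc k) \<omega>) =
        exp (\<alpha> * N k \<omega>) + \<alpha> / (1 - \<alpha>) * (W k \<omega> * exp (h (Suc k) (X (Suc k) \<omega>)))" for \<omega>
      by (simp add: doob_potential_def W_def R_def exp_add[symmetric] algebra_simps)
    have N_Suc: "N (Suc k) \<omega> = max (N k \<omega>) (R (Suc k) \<omega>)" for \<omega>
      by (simp add: N_def R_def)
    have "expectation (\<lambda>\<omega>. doob_potential \<alpha> (N (Suc k) \<omega>) (R (Suc k) \<omega>)) \<le>
        expectation (\<lambda>\<omega>. exp (\<alpha> * N k \<omega>) + \<alpha> / (1 - \<alpha>) * (W k \<omega> * exp (h (Suc k) (X (Suc k) \<omega>))))"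
    proof (rule integral_mono)
      show "doob_potential \<alpha> (N (Suc k) \<omega>) (R (Suc k) \<omega>) \<le>
          exp (\<alpha> * N k \<omega>) + \<alpha> / (1 - \<alpha>) * (W k \<omega> * exp (h (Suc k) (X (Suc k) \<omega>)))" for \<omega>
        unfolding step[symmetric] N_Suc by (rule doob_potential_max_le[OF \<alpha>])
    qed (use Suc.prems pot_int expN_int WV_int in auto)
    also have "\<dots> = expectation (\<lambda>\<omega>. exp (\<alpha> * N k \<omega>)) +
        \<alpha> / (1 - \<alpha>) * expectation (\<lambda>\<omega>. W k \<omega> * exp (h (Suc k) (X (Suc k) \<omega>)))"
      using Suc.prems expN_int[of k] WV_int[of k] by simp
    also have "\<dots> \<le> expectation (\<lambda>\<omega>. exp (\<alpha> * N k \<omega>)) + \<alpha> / (1 - \<alpha>) * expectation (W k)"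
      using na_step[OF Suc.prems] \<alpha> by (intro add_left_mono mult_left_mono) auto
    also have "\<dots> = expectation (\<lambda>\<omega>. doob_potential \<alpha> (N k \<omega>) (R k \<omega>))"
      unfolding potential using Suc.prems expN_int[of k] W_int[of k] by simp
    also have "\<dots> \<le> 1 / (1 - \<alpha>)"
      using Suc by simp
    finally show ?case .
  qed
  \<comment> \<open>The second term of the potential is nonnegative and is dropped.\<close>
  have "expectation (\<lambda>\<omega>. exp (\<alpha> * N n \<omega>)) \<le> expectation (\<lambda>\<omega>. doob_potential \<alpha> (N n \<omega>) (R n \<omega>))"
    using expN_int[of n] pot_int[of n] \<alpha> by (intro integral_mono) (auto simp: doob_potential_def)
  then show ?thesis
    using main[of n] by (simp add: N_def)
qed

section \<open>Tail bounds\<close>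

lemma negatively_associated_subset:
  assumes "negatively_associated M I X" "J \<subseteq> I"
  shows "negatively_associated M J X"
  unfolding negatively_associated_def
proof (intro allI impI)
  fix A1 A2 f1 f2
  assume *: "A1 \<subseteq> J" "A2 \<subseteq> J" and **: "A1 \<inter> A2 = {}" "coordinatewise_increasing A1 f1"
    "coordinatewise_increasing A2 f2"
    "covariance_exists M (\<lambda>\<omega>. f1 (\<lambda>i\<in>A1. X i \<omega>)) (\<lambda>\<omega>. f2 (\<lambda>j\<in>A2. X j \<omega>))"
  have "A1 \<subseteq> I" "A2 \<subseteq> I"
    using * assms(2) by auto
  then show "covariance M (\<lambda>\<omega>. f1 (\<lambda>i\<in>A1. X i \<omega>)) (\<lambda>\<omega>. f2 (\<lambda>j\<in>A2. X j \<omega>)) \<le> 0"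
    using assms(1)[unfolded negatively_associated_def, rule_format, of A1 A2 f1 f2] ** by blast
qed

lemma H_nonneg: "0 \<le> H n \<alpha> x v"
  by (simp add: H_def)

text \<open>On this event \<open>min (X i / y) 1\<close> equals \<open>X i / y\<close>, so
  truncation leaves the sums unchanged there, while globally it makes the exponentials bounded.
  Markov's inequality for \<open>exp (\<alpha> * N)\<close> produces the power
  \<open>\<alpha>\<close>. The parameter \<open>t\<close> stays free for the later
  optimisation.\<close>

lemma (in prob_space) prob_max_sum_truncated_le:
  fixes X :: "nat \<Rightarrow> 'a \<Rightarrow> real"
  assumes NA: "negatively_associated M {1..n} X"
    and X: "\<And>i. i \<in> {1..n} \<Longrightarrow> integrable M (X i)"
      "\<And>i. i \<in> {1..n} \<Longrightarrow> integrable M (\<lambda>\<omega>. (X i \<omega>)\<^sup>2)"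
    and mean: "\<And>i. i \<in> {1..n} \<Longrightarrow> expectation (X i) = 0"
    and \<alpha>: "0 < \<alpha>" "\<alpha> < 1" and y: "0 < y" and t: "0 \<le> t"
  shows "prob {\<omega>\<in>space M. (\<exists>k\<in>{1..n}. x < (\<Sum>i=1..k. X i \<omega>)) \<and> (\<forall>i\<in>{1..n}. X i \<omega> \<le> y)}
    \<le> inverse (1 - \<alpha>) *
      (exp (- t * (x / y)) * (\<Prod>i=1..n. bennett_mgf t (expectation (\<lambda>\<omega>. (X i \<omega>)\<^sup>2) / y\<^sup>2))) powr \<alpha>"
    (is "prob ?E \<le> _")
proof -
  define c where "c i = bennett_mgf t (expectation (\<lambda>\<omega>. (X i \<omega>)\<^sup>2) / y\<^sup>2)" for i
  \<comment> \<open>Subtracting \<open>ln (c i)\<close> brings the exponential moment down to at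
    most 1, as the maximal inequality demands.\<close>
  define h where "h i u = t * min (u / y) 1 - ln (c i)" for i u
  define N where "N \<omega> = running_max (\<lambda>i. h i (X i \<omega>)) n" for \<omega>
  define L where "L = (\<Sum>i=1..n. ln (c i))"
  have c: "1 \<le> c i" for i
    unfolding c_def by (intro one_le_bennett_mgf) simp
  then have ln_c: "0 \<le> ln (c i)" for i
    by simp
  have X_meas: "X i \<in> borel_measurable M" if "i \<in> {1..n}" for i
    using X(1)[OF that] by simp
  have mono_h: "mono (h i)" for i
    unfolding h_def using t y
    by (intro monoI diff_right_mono mult_left_mono min.mono divide_right_mono) auto
  have h_le: "h i u \<le> t" for i u
    using mult_left_mono[of "min (u / y) 1" 1 t] t ln_c[of i] by (simp add: h_def)
  have mgf: "expectation (\<lambda>\<omega>. exp (h i (X i \<omega>))) \<le> 1" if i: "i \<in> {1..n}" for i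
  proof -
    define U where "U \<omega> = min (X i \<omega> / y) 1" for \<omega>
    \<comment> \<open>Capping from above at 1 never increases the absolute value, so the second
      moment cannot grow.\<close>
    have U_le: "\<bar>U \<omega>\<bar> \<le> \<bar>X i \<omega> / y\<bar>" for \<omega>
      unfolding U_def by linarith
    then have U2_le: "(U \<omega>)\<^sup>2 \<le> (X i \<omega>)\<^sup>2 / y\<^sup>2" for \<omega>
      using abs_le_square_iff[of "U \<omega>" "X i \<omega> / y"] by (simp add: power_divide)
    have [measurable]: "U \<in> borel_measurable M"
      unfolding U_def using X_meas[OF i] by measurable
    have Xy: "integrable M (\<lambda>\<omega>. X i \<omega> / y)" "integrable M (\<lambda>\<omega>. (X i \<omega>)\<^sup>2 / y\<^sup>2)"
      using X[OF i] by auto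
    have U: "integrable M U"
      using U_le by (intro Bochner_Integration.integrable_bound[OF Xy(1)]) auto
    have U2: "integrable M (\<lambda>\<omega>. (U \<omega>)\<^sup>2)"
      using U2_le by (intro Bochner_Integration.integrable_bound[OF Xy(2)]) auto
    have "expectation U \<le> expectation (\<lambda>\<omega>. X i \<omega> / y)"
      using U Xy by (intro integral_mono) (auto simp: U_def)
    then have "expectation U \<le> 0"
      using mean[OF i] by simp
    moreover have "expectation (\<lambda>\<omega>. (U \<omega>)\<^sup>2) \<le> expectation (\<lambda>\<omega>. (X i \<omega>)\<^sup>2 / y\<^sup>2)"
      using U2 Xy U2_le by (intro integral_mono) auto
    moreover have "U \<omega> \<le> 1" for \<omega>
      by (simp add: U_def)
    ultimately have "expectation (\<lambda>\<omega>. exp (t * U \<omega>)) \<le> c i"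
      unfolding c_def using U U2 t by (intro expectation_exp_le_bennett_mgf) auto
    moreover have "exp (h i (X i \<omega>)) = exp (t * U \<omega>) / c i" for \<omega>
      using c[of i] by (simp add: h_def U_def exp_diff)
    ultimately show ?thesis
      using c[of i] by simp
  qed
  have N_meas[measurable]: "N \<in> borel_measurable M"
    unfolding N_def using X_meas borel_measurable_mono[OF mono_h]
    by (intro borel_measurable_running_max) (auto intro: measurable_compose)
  have N_le: "N \<omega> \<le> n * t" for \<omega>
    unfolding N_def using h_le t by (intro running_max_le) auto
  have int: "integrable M (\<lambda>\<omega>. exp (\<alpha> * N \<omega>))"
    using N_le \<alpha> by (intro integrable_const_bound[where B = "exp (\<alpha> * (n * t))"]) (auto intro!: AE_I2)
  have "?E \<subseteq> {\<omega>\<in>space M. exp (\<alpha> * (t * (x / y) - L)) \<le> exp (\<alpha> * N \<omega>)}"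
  proof
    fix \<omega> assume \<omega>: "\<omega> \<in> ?E"
    then obtain k where k: "k \<in> {1..n}" and gt: "x < (\<Sum>i=1..k. X i \<omega>)"
      and le: "\<forall>i\<in>{1..n}. X i \<omega> \<le> y"
      by blast
    have "t * (x / y) \<le> t * ((\<Sum>i=1..k. X i \<omega>) / y)"
      using gt t y by (intro mult_left_mono divide_right_mono) auto
    also have "\<dots> = (\<Sum>i=1..k. h i (X i \<omega>)) + (\<Sum>i=1..k. ln (c i))"
      unfolding sum.distrib[symmetric] sum_divide_distrib sum_distrib_left
      using le k y by (intro sum.cong) (auto simp: h_def)
    \<comment> \<open>Nonnegativity of \<open>ln (c i)\<close> permits the passage from the first
      \<open>k\<close> logarithms to all \<open>n\<close>.\<close>
    also have "\<dots> \<le> N \<omega> + L"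
      unfolding N_def L_def using k ln_c
      by (intro add_mono sum_le_running_max sum_mono2) auto
    finally show "\<omega> \<in> {\<omega>\<in>space M. exp (\<alpha> * (t * (x / y) - L)) \<le> exp (\<alpha> * N \<omega>)}"
      using \<alpha> \<omega> by simp
  qed
  then have "prob ?E \<le> prob {\<omega>\<in>space M. exp (\<alpha> * (t * (x / y) - L)) \<le> exp (\<alpha> * N \<omega>)}"
    by (intro finite_measure_mono) auto
  also have "\<dots> \<le> expectation (\<lambda>\<omega>. exp (\<alpha> * N \<omega>)) / exp (\<alpha> * (t * (x / y) - L))"
    using int by (intro integral_Markov_inequality_measure[where A = "{}"]) auto
  also have "\<dots> \<le> (1 / (1 - \<alpha>)) / exp (\<alpha> * (t * (x / y) - L))"
    unfolding N_def using NA X_meas mono_h h_le mgf \<alpha>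
    by (intro divide_right_mono expectation_exp_running_max_le) auto
  also have "\<dots> = inverse (1 - \<alpha>) * exp (\<alpha> * (- t * (x / y) + L))"
    by (simp add: divide_inverse exp_minus[symmetric] algebra_simps)
  also have "exp (\<alpha> * (- t * (x / y) + L)) = (exp (- t * (x / y)) * (\<Prod>i=1..n. c i)) powr \<alpha>"
  proof -
    have prod_c: "(\<Prod>i=1..n. c i) = exp L"
      unfolding L_def exp_sum[OF finite_atLeastAtMost]
      using c by (intro prod.cong) (auto intro!: exp_ln[symmetric] less_le_trans[OF zero_less_one])
    show ?thesis
      unfolding prod_c by (simp add: exp_add[symmetric] powr_def)
  qed
  finally show ?thesis
    unfolding c_def .
qed

text \<open>The supremum in each weak moment is at least its value at level \<open>y\<close>.
  Finiteness of the sum makes \<open>enn2real\<close> faithful, since it sends infinity to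
  0.\<close>

lemma (in prob_space) sum_prob_abs_gt_le:
  assumes fin: "A_sum M X n p < \<infinity>" and y: "0 < y"
  shows "(\<Sum>i=1..n. prob {\<omega>\<in>space M. y < \<bar>X i \<omega>\<bar>}) \<le> enn2real (A_sum M X n p) / y powr p"
proof -
  have "ennreal (\<Sum>i=1..n. y powr p * prob {\<omega>\<in>space M. y < \<bar>X i \<omega>\<bar>}) =
      (\<Sum>i=1..n. ennreal (y powr p * prob {\<omega>\<in>space M. y < \<bar>X i \<omega>\<bar>}))"
    by (intro sum_ennreal[symmetric]) auto
  also have "\<dots> \<le> A_sum M X n p"
    unfolding A_sum_def weak_moment_def using y by (intro sum_mono SUP_upper) auto
  also have "\<dots> = ennreal (enn2real (A_sum M X n p))"
    using fin by simp
  finally have "(\<Sum>i=1..n. y powr p * prob {\<omega>\<in>space M. y < \<bar>X i \<omega>\<bar>}) \<le> enn2real (A_sum M X n p)"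
    by (subst (asm) ennreal_le_iff) auto
  then show ?thesis
    using y by (simp add: sum_distrib_left[symmetric] pos_le_divide_eq mult.commute)
qed

section \<open>Combining the truncated bound with the exceptional event\<close>

theorem proposition2p2:
  fixes M :: "'a measure" and X :: "nat \<Rightarrow> 'a \<Rightarrow> real" and n :: nat and \<alpha> p x y :: real
  assumes "prob_space M"
    and "\<And>i. i \<ge> 1 \<Longrightarrow> X i \<in> borel_measurable M"
    and "negatively_associated_seq M X"
    and "\<And>i. i \<ge> 1 \<Longrightarrow> integrable M (X i)"
    and "\<And>i. i \<ge> 1 \<Longrightarrow> (\<integral>\<omega>. X i \<omega> \<partial>M) = 0"
    and "n \<ge> 1" and "0 < \<alpha>" and "\<alpha> < 1" and "p \<ge> 2"
    and "B_sum M X n < \<infinity>"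
    and "A_sum M X n p < \<infinity>"
    and "x > 0" and "y > 0"
  shows "measure M {\<omega>\<in>space M. (MAX k\<in>{1..n}. \<Sum>i=1..k. X i \<omega>) > x}
    \<le> inverse (1 - \<alpha>) * H n \<alpha> (\<alpha> * x / y) (sqrt (enn2real (B_sum M X n)) / y)
       + enn2real (A_sum M X n p) / y powr p"
proof -
  interpret prob_space M by fact
  let ?E = "{\<omega>\<in>space M. (\<exists>k\<in>{1..n}. x < (\<Sum>i=1..k. X i \<omega>)) \<and> (\<forall>i\<in>{1..n}. X i \<omega> \<le> y)}"
  let ?H = "H n \<alpha> (\<alpha> * x / y) (sqrt (enn2real (B_sum M X n)) / y)"
  have meas: "X i \<in> borel_measurable M" if "i \<in> {1..n}" for i
    using assms(2) that by simp
  have gt_sets: "{\<omega>\<in>space M. y < \<bar>X i \<omega>\<bar>} \<in> sets M" if "i \<in> {1..n}" for i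
    using meas[OF that] by measurable
  \<comment> \<open>The sequence condition speaks of at least two variables; \<open>max 2 n\<close>
    followed by restriction covers \<open>n = 1\<close>.\<close>
  have "negatively_associated M {1..max 2 n} X"
    using assms(3) unfolding negatively_associated_seq_def by (meson max.cobounded1)
  then have NA: "negatively_associated M {1..n} X"
    by (rule negatively_associated_subset) auto
  define B where "B = (\<Sum>i=1..n. expectation (\<lambda>\<omega>. (X i \<omega>)\<^sup>2))"
  have X2: "integrable M (\<lambda>\<omega>. (X i \<omega>)\<^sup>2)" if "i \<in> {1..n}" for i
  proof -
    have "(\<integral>\<^sup>+\<omega>. ennreal ((X i \<omega>)\<^sup>2) \<partial>M) \<le> B_sum M X n"
      unfolding B_sum_def using that by (intro member_le_sum) auto
    then show ?thesis
      using assms(10) meas[OF that] by (intro integrableI_nonneg) auto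
  qed
  have "B_sum M X n = (\<Sum>i=1..n. ennreal (expectation (\<lambda>\<omega>. (X i \<omega>)\<^sup>2)))"
    unfolding B_sum_def using X2 by (intro sum.cong nn_integral_eq_integral) auto
  then have B: "enn2real (B_sum M X n) = B" "0 \<le> B"
    by (simp_all add: B_def sum_ennreal sum_nonneg)
  have "prob ?E \<le> inverse (1 - \<alpha>) * ?H"
  proof -
    \<comment> \<open>The optimal parameter needs positive variance and
      \<open>\<alpha> * x / y < n\<close>. In the other cases the event is null or empty and
      \<open>H_nonneg\<close> settles the claim; the convention case
      \<open>\<alpha> * x / y = n\<close> belongs to the second.\<close>
    consider "B = 0" | "n \<le> \<alpha> * x / y" | "0 < B" "\<alpha> * x / y < n"
      using B(2) by linarith
    then show ?thesis
    proof cases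
      case 1
      have "AE \<omega> in M. X i \<omega> = 0" if "i \<in> {1..n}" for i
      proof -
        have "expectation (\<lambda>\<omega>. (X i \<omega>)\<^sup>2) = 0"
          using 1 that by (auto simp: B_def sum_nonneg_eq_0_iff)
        then show ?thesis
          using integral_nonneg_eq_0_iff_AE[OF X2[OF that]] by simp
      qed
      then have "AE \<omega> in M. \<forall>i\<in>{1..n}. X i \<omega> = 0"
        by (simp add: AE_ball_countable)
      then have "AE \<omega> in M. \<omega> \<in> ?E \<longrightarrow> \<omega> \<in> {}"
        by eventually_elim (use assms(12) in auto)
      then have "prob ?E \<le> prob {}"
        by (intro finite_measure_mono_AE) auto
      then show ?thesis
        using assms(8) H_nonneg[of n \<alpha>] by (auto intro: order_trans)
    next
      case 2
      have "?E = {}"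
      proof (rule ccontr)
        assume "?E \<noteq> {}"
        then obtain \<omega> k where k: "k \<in> {1..n}" "x < (\<Sum>i=1..k. X i \<omega>)" "\<forall>i\<in>{1..n}. X i \<omega> \<le> y"
          by blast
        have "(\<Sum>i=1..k. X i \<omega>) \<le> of_nat (card {1..k}) * y"
          using k by (intro sum_bounded_above) auto
        also have "\<dots> \<le> n * y"
          using k assms(13) by (intro mult_right_mono) auto
        also have "\<dots> \<le> \<alpha> * x"
          using 2 assms(13) by (simp add: pos_le_divide_eq)
        also have "\<dots> < x"
          using assms(8,12) by simp
        finally show False
          using k by simp
      qed
      then show ?thesis
        using assms(8) H_nonneg[of n \<alpha>] by (simp only:) simp
    next
      case 3
      define x' where "x' = \<alpha> * x / y"
      define V where "V = B / y\<^sup>2"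
      define s where "s i = expectation (\<lambda>\<omega>. (X i \<omega>)\<^sup>2) / y\<^sup>2" for i
      have x': "0 < x'" "x' < n" and V: "0 < V"
        using 3 assms by (simp_all add: x'_def V_def)
      obtain t where t: "0 < t" "exp (- t * x') * (\<Prod>i=1..n. bennett_mgf t (s i)) \<le>
          ((V / (x' + V)) powr (x' + V) * (n / (n - x')) powr (n - x')) powr (n / (n + V))"
        using exists_optimal_bennett_parameter[of n s V x'] V x'
        by (auto simp: s_def V_def B_def sum_divide_distrib)
      have pos: "0 \<le> (\<Prod>i=1..n. bennett_mgf t (s i))"
        by (intro prod_nonneg) (auto simp: s_def intro!: order_trans[OF zero_le_one one_le_bennett_mgf])
      have "prob ?E \<le> inverse (1 - \<alpha>) *
          (exp (- t * (x / y)) * (\<Prod>i=1..n. bennett_mgf t (s i))) powr \<alpha>"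
        unfolding s_def using NA assms X2 t by (intro prob_max_sum_truncated_le) auto
      \<comment> \<open>The exponent is weakened from \<open>x / y\<close> to the smaller
        \<open>\<alpha> * x / y\<close>, at which \<open>H\<close> is evaluated and for which
        \<open>t\<close> was chosen.\<close>
      also have "\<dots> \<le> inverse (1 - \<alpha>) *
          (exp (- t * x') * (\<Prod>i=1..n. bennett_mgf t (s i))) powr \<alpha>"
        using assms t pos
        by (intro mult_left_mono powr_mono2 mult_right_mono)
          (auto simp: x'_def divide_right_mono mult_nonneg_nonneg)
      also have "\<dots> \<le> inverse (1 - \<alpha>) *
          (((V / (x' + V)) powr (x' + V) * (n / (n - x')) powr (n - x')) powr (n / (n + V))) powr \<alpha>"
        using assms t pos by (intro mult_left_mono powr_mono2) auto
      \<comment> \<open>Since \<open>x' < n\<close>, the indicator is 1 and the convention branch is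
        avoided; \<open>V\<close> is the square of \<open>sqrt B / y\<close>, and the two outer
        powers merge.\<close>
      also have "\<dots> = inverse (1 - \<alpha>) * ?H"
        using x' B by (simp add: H_def x'_def[symmetric] power_divide V_def[symmetric] powr_powr mult.commute)
      finally show ?thesis .
    qed
  qed
  moreover have "measure M {\<omega>\<in>space M. (MAX k\<in>{1..n}. \<Sum>i=1..k. X i \<omega>) > x} \<le>
      prob ?E + (\<Sum>i=1..n. prob {\<omega>\<in>space M. y < \<bar>X i \<omega>\<bar>})"
  proof -
    have "?E \<in> sets M"
      using meas by measurable
    \<comment> \<open>If the maximum exceeds \<open>x\<close> outside \<open>?E\<close>, some
      \<open>X i\<close> exceeds \<open>y\<close>, and so does its absolute value.\<close>
    have "measure M {\<omega>\<in>space M. (MAX k\<in>{1..n}. \<Sum>i=1..k. X i \<omega>) > x} \<le>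
        prob (?E \<union> (\<Union>i\<in>{1..n}. {\<omega>\<in>space M. y < \<bar>X i \<omega>\<bar>}))"
    proof (rule finite_measure_mono)
      show "?E \<union> (\<Union>i\<in>{1..n}. {\<omega>\<in>space M. y < \<bar>X i \<omega>\<bar>}) \<in> sets M"
        using \<open>?E \<in> sets M\<close> gt_sets by auto
      show "{\<omega>\<in>space M. (MAX k\<in>{1..n}. \<Sum>i=1..k. X i \<omega>) > x} \<subseteq>
          ?E \<union> (\<Union>i\<in>{1..n}. {\<omega>\<in>space M. y < \<bar>X i \<omega>\<bar>})"
        using assms(6) by (auto simp: Max_gr_iff not_less)
    qed
    also have "\<dots> \<le> prob ?E + prob (\<Union>i\<in>{1..n}. {\<omega>\<in>space M. y < \<bar>X i \<omega>\<bar>})"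
      using \<open>?E \<in> sets M\<close> gt_sets by (intro measure_Un_le) auto
    also have "\<dots> \<le> prob ?E + (\<Sum>i=1..n. prob {\<omega>\<in>space M. y < \<bar>X i \<omega>\<bar>})"
      using gt_sets by (intro add_left_mono finite_measure_subadditive_finite) auto
    finally show ?thesis .
  qed
  moreover have "(\<Sum>i=1..n. prob {\<omega>\<in>space M. y < \<bar>X i \<omega>\<bar>}) \<le> enn2real (A_sum M X n p) / y powr p"
    using assms by (intro sum_prob_abs_gt_le) auto
  ultimately show ?thesis
    by linarith
qed

end
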